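(* There is a constant $c > 0$ such that, for every sequence $X = X_n$ of finite sets, each consisting of elements of some additive (Abelian) group, such that $|X| \to \infty$, and for every sequence $p = p_n \in [0,1]$ with $p \le c \cdot |X|^{-1/2}$, \[ \Pr\big(X_p \text{ is list-Schur}\big) \to 0 . \]
   Context: For a finite set $X$ and $p \in [0,1]$, $X_p$ denotes the random subset of $X$ obtained by retaining each element independently with probability $p$. A set $Y$ of elements of an additive group is list-Schur if there exists an assignment of two-element lists of colours to the elements of $Y$ such that every colouring of $Y$ in which each element receives a colour from its list admits a monochromatic sum, i.e. three distinct elements $a,b,c\in Y$ of the same colour with $a+b=c$. *)

theory Defs
  imports "HOL-Algebra.Group" "HOL-Probability.Probability"
begin

text \<open>
  Abelian groups are the \<open>comm_group\<close>s of HOL-Algebra, so the paper's \<open>a + b\<close> is written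
  \<open>a \<otimes> b\<close>.  Only finite sets \<open>Y\<close> matter below, and an assignment of two-element lists to a
  finite set uses finitely many colours, so colours may be taken to be natural numbers.
\<close>

definition list_schur :: "('a, 'b) monoid_scheme \<Rightarrow> 'a set \<Rightarrow> bool" where
  "list_schur G Y \<longleftrightarrow>
    (\<exists>L :: 'a \<Rightarrow> nat set. (\<forall>y\<in>Y. card (L y) = 2) \<and>
      (\<forall>col :: 'a \<Rightarrow> nat. (\<forall>y\<in>Y. col y \<in> L y) \<longrightarrow>
        (\<exists>a\<in>Y. \<exists>b\<in>Y. \<exists>c\<in>Y. a \<noteq> b \<and> a \<noteq> c \<and> b \<noteq> c \<and>
          col a = col b \<and> col b = col c \<and> a \<otimes>\<^bsub>G\<^esub> b = c)))"

definition random_subset :: "'a set \<Rightarrow> real \<Rightarrow> 'a set pmf" where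
  "random_subset X p =
    map_pmf (\<lambda>f. {x\<in>X. f x}) (Pi_pmf X False (\<lambda>_. bernoulli_pmf p))"

text \<open>
  \<open>not_list_schur_whp TYPE('a) c\<close>: the constant \<open>c\<close> works for all sequences of sets in
  abelian groups (possibly a different group for each \<open>n\<close>) whose elements are of type \<open>'a\<close>.
  The bound on \<open>p n\<close> is void for \<open>X n = {}\<close>, where \<open>0 powr (-1/2)\<close> is \<open>0\<close> in HOL.
\<close>

definition not_list_schur_whp :: "'a itself \<Rightarrow> real \<Rightarrow> bool" where
  "not_list_schur_whp T c \<longleftrightarrow>
    (\<forall>(G :: nat \<Rightarrow> 'a monoid) (X :: nat \<Rightarrow> 'a set) (p :: nat \<Rightarrow> real).
      (\<forall>n. comm_group (G n)) \<longrightarrow>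
      (\<forall>n. finite (X n) \<and> X n \<subseteq> carrier (G n)) \<longrightarrow>
      filterlim (\<lambda>n. card (X n)) at_top sequentially \<longrightarrow>
      (\<forall>n. 0 \<le> p n \<and> p n \<le> 1) \<longrightarrow>
      (\<forall>n. X n \<noteq> {} \<longrightarrow> p n \<le> c * real (card (X n)) powr (- 1 / 2)) \<longrightarrow>
      (\<lambda>n. measure_pmf.prob (random_subset (X n) (p n)) {Y. list_schur (G n) Y})
        \<longlonglongrightarrow> 0)"

text \<open>
  HOL cannot quantify over types below an existential quantifier, so
  \<open>\<exists>c>0. not_list_schur_whp TYPE('a) c\<close> would let \<open>c\<close> depend on the type of the group elements.
  That a single \<open>c\<close> works for all types is expressed in two parts: some \<open>c > 0\<close> works for
  \<open>nat\<close>, and every \<open>c > 0\<close> that works for \<open>nat\<close> works for an arbitrary type \<open>'a\<close>.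
\<close>

end

theory Submission
  imports Defs "HOL-Algebra.Generated_Groups"
begin

text \<open>
  The Schur triples in \<open>X\<close> form a 3-uniform hypergraph in which two vertices lie in at most three
  common edges. With \<open>N = |X|\<close> there are at most \<open>N (3 N)\<^sup>k\<close> loose paths with \<open>k\<close> edges; if
  \<open>N p\<^sup>2\<close> is small, then a union bound shows that with high probability \<open>X\<^sub>p\<close> contains no loose path
  together with two further edges, each of which adds just one new vertex.

  A hypergraph without this configuration can be coloured from lists of size two. In a minimal
  counterexample the longest loose paths must close up to a loose cycle, and this cycle meets no edge
  other than those inside it. Colouring its vertices in consecutive pairs with distinct colours
  then works, except for the Pasch configuration, which has its own colouring.

  A constant for \<open>nat\<close> carries over to every type because only the countable subgroup generated
  by \<open>X\<close> matters.
\<close>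

section \<open>List colourings of 3-uniform hypergraphs\<close>

text \<open>
  A loose path is coded by its vertices \<open>v\<^sub>0, w\<^sub>1, v\<^sub>1, w\<^sub>2, v\<^sub>2, \<dots>\<close>, with edges
  \<open>{v\<^sub>0, w\<^sub>1, v\<^sub>1}, {v\<^sub>1, w\<^sub>2, v\<^sub>2}, \<dots>\<close>; in a loose cycle the last edge is
  \<open>{last, t, v\<^sub>0}\<close>, where \<open>t\<close> stands at the front of the list.
\<close>

fun lpath :: "'a set set \<Rightarrow> 'a list \<Rightarrow> bool" where
  "lpath E [] \<longleftrightarrow> False"
| "lpath E [x] \<longleftrightarrow> True"
| "lpath E (a # b # xs) \<longleftrightarrow>
    lpath E xs \<and> {a, b, hd xs} \<in> E \<and> a \<noteq> b \<and> a \<notin> set xs \<and> b \<notin> set xs"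

definition loose_cycle :: "'a set set \<Rightarrow> 'a list \<Rightarrow> bool" where
  "loose_cycle E zs \<longleftrightarrow>
    (\<exists>t xs. zs = t # xs \<and> 3 \<le> length xs \<and> t \<notin> set xs \<and> lpath E xs \<and> {last xs, t, hd xs} \<in> E)"

text \<open>
  Each of \<open>f\<close> and \<open>g\<close> adds one vertex that is determined, up to boundedly many choices, by two
  earlier ones; in a random subset such a step costs a factor of order \<open>|X| powr (- 1 / 2)\<close>.
\<close>

definition bicyclic :: "'a set set \<Rightarrow> bool" where
  "bicyclic E \<longleftrightarrow>
    (\<exists>xs f g y z. lpath E xs \<and> f \<in> E \<and> g \<in> E \<and> f - set xs = {y} \<and> g - (set xs \<union> f) = {z})"

definition colourable :: "('a \<Rightarrow> nat set) \<Rightarrow> 'a set set \<Rightarrow> bool" where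
  "colourable L E \<longleftrightarrow>
    (\<exists>col. (\<forall>v. col v \<in> L v) \<and> (\<forall>e\<in>E. \<exists>u\<in>e. \<exists>v\<in>e. col u \<noteq> col v))"

lemma bicyclicI:
  assumes "lpath E xs" "f \<in> E" "g \<in> E" "f - set xs = {y}" "g - (set xs \<union> f) = {z}"
  shows "bicyclic E"
  using assms unfolding bicyclic_def by blast

lemma lpath_mono: "lpath E xs \<Longrightarrow> E \<subseteq> F \<Longrightarrow> lpath F xs"
  by (induction E xs rule: lpath.induct) auto

lemma bicyclic_mono: "bicyclic E \<Longrightarrow> E \<subseteq> F \<Longrightarrow> bicyclic F"
  unfolding bicyclic_def by (metis lpath_mono subsetD)

lemma lpath_distinct: "lpath E xs \<Longrightarrow> distinct xs"
  by (induction E xs rule: lpath.induct) auto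

lemma lpath_odd: "lpath E xs \<Longrightarrow> odd (length xs)"
  by (induction E xs rule: lpath.induct) auto

text \<open>A one-vertex path has no edge, so its vertex may lie outside every edge; hence the
  exception.\<close>

lemma lpath_set_subset: "lpath E xs \<Longrightarrow> length xs = 1 \<or> set xs \<subseteq> \<Union>E"
proof (induction E xs rule: lpath.induct)
  case (3 E a b xs)
  then have "set xs \<subseteq> \<Union>E"
    by (cases "length xs = 1") (auto simp: length_Suc_conv)
  moreover have "{a, b} \<subseteq> \<Union>E" using 3(2) by (auto intro!: bexI[of _ "{a, b, hd xs}"])
  ultimately show ?case by auto
qed auto

lemma lpath_snoc:
  "lpath E xs \<Longrightarrow> {last xs, a, b} \<in> E \<Longrightarrow> a \<noteq> b \<Longrightarrow> a \<notin> set xs \<Longrightarrow> b \<notin> set xs \<Longrightarrow>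
    lpath E (xs @ [a, b])"
proof (induction E xs rule: lpath.induct)
  case (2 E x)
  then show ?case by (auto simp: insert_commute)
next
  case (3 E c d xs)
  then have "xs \<noteq> []" by auto
  with 3 show ?case by auto
qed auto

lemma lpath_rev: "lpath E xs \<Longrightarrow> lpath E (rev xs)"
proof (induction E xs rule: lpath.induct)
  case (3 E a b xs)
  then have "xs \<noteq> []" by auto
  with 3 have "lpath E (rev xs @ [b, a])"
    by (intro lpath_snoc) (auto simp: last_rev insert_commute)
  then show ?case by simp
qed auto

text \<open>The first edge shares only \<open>hd xs\<close> with the rest of the path, so either of
  its other two vertices may serve as the end vertex.\<close>

lemma lpath_swap: "lpath E (a # b # xs) \<Longrightarrow> lpath E (b # a # xs)"
  by (auto simp: insert_commute)

lemma lpath_swap_last: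
  assumes "lpath E (xs @ [a, b])"
  shows "lpath E (xs @ [b, a])"
  using lpath_rev[of E "b # a # rev xs"] lpath_swap[of E b a "rev xs"] lpath_rev[OF assms]
    lpath_rev[of E "a # b # rev xs"] by simp

lemma length_ge_3_obtain:
  assumes "3 \<le> length xs"
  obtains a b c ys where "xs = a # b # c # ys"
  using assms by (auto simp: numeral_3_eq_3 Suc_le_length_iff)

lemma loose_cycle_distinct: "loose_cycle E zs \<Longrightarrow> distinct zs"
  unfolding loose_cycle_def by (auto dest: lpath_distinct)

lemma loose_cycle_cases:
  assumes "loose_cycle E zs"
  obtains t v w xs where "zs = t # v # w # xs" "xs \<noteq> []" "lpath E xs"
    "lpath E (v # w # xs)" "{last xs, t, v} \<in> E" "{v, w, hd xs} \<in> E" "distinct zs"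
proof -
  obtain t ys where zs: "zs = t # ys" "3 \<le> length ys" "lpath E ys" "{last ys, t, hd ys} \<in> E"
    using assms unfolding loose_cycle_def by auto
  moreover from zs(2) obtain v w x xs where "ys = v # w # x # xs"
    by (meson length_ge_3_obtain)
  ultimately show ?thesis
    using that[of t v w "x # xs"] loose_cycle_distinct[OF assms] by auto
qed

lemma loose_cycle_ConsD:
  assumes "loose_cycle E (t # v # w # xs)"
  shows "xs \<noteq> []" "lpath E xs" "{last xs, t, v} \<in> E" "{v, w, hd xs} \<in> E"
    "distinct (t # v # w # xs)"
  by (rule loose_cycle_cases[OF assms]; simp)+

text \<open>The old closing edge \<open>{last xs, t, v}\<close> is appended to the path
  \<open>xs\<close>, and \<open>{v, w, hd xs}\<close> becomes the closing edge with \<open>w\<close>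
  in the middle.\<close>

lemma loose_cycle_rotate2:
  assumes "loose_cycle E zs"
  shows "loose_cycle E (rotate 2 zs)"
proof -
  obtain t v w xs where zs: "zs = t # v # w # xs" and ne: "xs \<noteq> []" and p: "lpath E xs"
    and e: "{last xs, t, v} \<in> E" "{v, w, hd xs} \<in> E" and d: "distinct zs"
    using loose_cycle_cases[OF assms] by metis
  have "lpath E (xs @ [t, v])"
    using p e d by (intro lpath_snoc) (auto simp: zs)
  moreover have "rotate 2 zs = w # xs @ [t, v]"
    by (simp add: zs numeral_2_eq_2)
  moreover have "{last (xs @ [t, v]), w, hd (xs @ [t, v])} \<in> E"
    using e(2) ne by (simp add: insert_commute)
  moreover have "3 \<le> length (xs @ [t, v])" using ne by (cases xs) simp_all
  moreover have "w \<notin> set (xs @ [t, v])" using d by (auto simp: zs)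
  ultimately show ?thesis unfolding loose_cycle_def by blast
qed

lemma loose_cycle_rotate: "loose_cycle E zs \<Longrightarrow> loose_cycle E (rotate (2 * j) zs)"
proof (induction j)
  case (Suc j)
  have "rotate (2 * Suc j) zs = rotate 2 (rotate (2 * j) zs)"
    by (simp add: rotate_rotate)
  then show ?case using Suc loose_cycle_rotate2[of E "rotate (2 * j) zs"] by simp
qed simp

lemma loose_cycle_length: "loose_cycle E zs \<Longrightarrow> 4 \<le> length zs \<and> even (length zs)"
  unfolding loose_cycle_def by (auto dest: lpath_odd)

lemma card_2_obtain_neq:
  assumes "card A = 2"
  obtains x where "x \<in> A" "x \<noteq> y"
  using assms by (metis card_2_iff insertCI)

text \<open>Greedy choice: a list of size two always offers the second vertex of a pair a colour
  other than that of the first, and distinctness keeps the pairs from interfering.\<close>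

lemma pair_colouring:
  assumes L: "\<And>v. card (L v :: nat set) = 2"
  shows "distinct zs \<Longrightarrow>
    \<exists>col. (\<forall>v. col v \<in> L v) \<and>
      (\<forall>i. 2 * i + 1 < length zs \<longrightarrow> col (zs ! (2 * i)) \<noteq> col (zs ! (2 * i + 1)))"
proof (induction zs rule: induct_list012)
  case 1
  have "\<forall>v. \<exists>c. c \<in> L v" using L by (metis card_2_iff insertCI)
  then show ?case by (auto dest: choice)
next
  case (2 x)
  have "\<forall>v. \<exists>c. c \<in> L v" using L by (metis card_2_iff insertCI)
  then show ?case by (auto dest: choice)
next
  case (3 x y zs)
  then obtain col where col: "\<forall>v. col v \<in> L v"
    "\<And>i. 2 * i + 1 < length zs \<Longrightarrow> col (zs ! (2 * i)) \<noteq> col (zs ! (2 * i + 1))"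
    by auto
  obtain c where c: "c \<in> L y" "c \<noteq> col x" using card_2_obtain_neq[OF L] .
  have "(col(y := c)) ((x # y # zs) ! (2 * i)) \<noteq> (col(y := c)) ((x # y # zs) ! (2 * i + 1))"
    if i: "2 * i + 1 < length (x # y # zs)" for i
  proof (cases i)
    case 0
    then show ?thesis using c 3(3) by auto
  next
    case (Suc j)
    then have j: "2 * j + 1 < length zs" using i by simp
    then have "zs ! (2 * j) \<in> set zs" "zs ! (2 * j + 1) \<in> set zs" by auto
    with 3(3) have "zs ! (2 * j) \<noteq> y" "zs ! (2 * j + 1) \<noteq> y" by auto
    then show ?thesis using Suc col(2)[OF j] by simp
  qed
  moreover have "\<forall>v. (col(y := c)) v \<in> L v" using col(1) c by auto
  ultimately show ?case by blast
qed

section \<open>Minimal counterexamples to list colouring, to be shown inconsistent\<close>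

locale critical_hypergraph =
  fixes E :: "'a set set" and L :: "'a \<Rightarrow> nat set"
  assumes finite_E: "finite E"
    and card_edge: "e \<in> E \<Longrightarrow> card e = 3"
    and card_L: "card (L v) = 2"
    and not_bicyclic: "\<not> bicyclic E"
    and not_colourable: "\<not> colourable L E"
    and colourable_subset: "F \<subset> E \<Longrightarrow> colourable L F"
begin

text \<open>Otherwise \<open>u\<close> and \<open>w\<close> lie in the same edges. By minimality the
  edges avoiding \<open>u\<close> can be coloured; recolouring \<open>u\<close> to differ from
  \<open>w\<close> then takes care of all edges through \<open>u\<close>.\<close>

lemma separating_edge:
  assumes "e \<in> E" "u \<in> e" "u \<noteq> w"
  shows "\<exists>g\<in>E. (u \<in> g) \<noteq> (w \<in> g)"
proof (rule ccontr)
  assume "\<not> ?thesis"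
  then have iff: "u \<in> g \<longleftrightarrow> w \<in> g" if "g \<in> E" for g using that by auto
  have "{g \<in> E. u \<notin> g} \<subset> E" using assms by auto
  from colourable_subset[OF this] obtain col where col: "\<forall>v. col v \<in> L v"
    "\<And>g. g \<in> E \<Longrightarrow> u \<notin> g \<Longrightarrow> \<exists>x\<in>g. \<exists>y\<in>g. col x \<noteq> col y"
    unfolding colourable_def by auto
  obtain c where c: "c \<in> L u" "c \<noteq> col w" using card_2_obtain_neq[OF card_L] .
  have "\<exists>x\<in>g. \<exists>y\<in>g. (col(u := c)) x \<noteq> (col(u := c)) y" if g: "g \<in> E" for g
  proof (cases "u \<in> g")
    case True
    then show ?thesis using iff[OF g] c assms(3) by (intro bexI[of _ u] bexI[of _ w]) auto
  next
    case False
    then obtain x y where "x \<in> g" "y \<in> g" "col x \<noteq> col y" using col(2) g by blast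
    moreover from this False have "x \<noteq> u" "y \<noteq> u" by auto
    ultimately show ?thesis by (metis fun_upd_other)
  qed
  moreover have "\<forall>v. (col(u := c)) v \<in> L v" using col(1) c by auto
  ultimately have "colourable L E" unfolding colourable_def by blast
  then show False using not_colourable by simp
qed

text \<open>Otherwise the edges inside \<open>C\<close> and the edges disjoint from \<open>C\<close>
  are two proper subsets of \<open>E\<close>, and a colouring of the one on \<open>C\<close> can be
  glued to a colouring of the other outside \<open>C\<close>.\<close>

lemma connected:
  assumes C: "\<And>g. g \<in> E \<Longrightarrow> g \<subseteq> C \<or> g \<inter> C = {}" and e: "e \<in> E" "e \<subseteq> C" and g: "g \<in> E"
  shows "g \<subseteq> C"
proof (rule ccontr)
  assume ng: "\<not> g \<subseteq> C"
  have "e \<noteq> {}" using card_edge[OF e(1)] by auto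
  then have "{g \<in> E. g \<subseteq> C} \<subset> E" "{g \<in> E. g \<inter> C = {}} \<subset> E" using e g ng by auto
  from colourable_subset[OF this(1)] colourable_subset[OF this(2)]
  obtain c d where c: "\<forall>v. c v \<in> L v" "\<And>g. g \<in> E \<Longrightarrow> g \<subseteq> C \<Longrightarrow> \<exists>x\<in>g. \<exists>y\<in>g. c x \<noteq> c y"
    and d: "\<forall>v. d v \<in> L v" "\<And>g. g \<in> E \<Longrightarrow> g \<inter> C = {} \<Longrightarrow> \<exists>x\<in>g. \<exists>y\<in>g. d x \<noteq> d y"
    unfolding colourable_def by auto
  define h where "h v = (if v \<in> C then c v else d v)" for v
  have "\<exists>x\<in>g. \<exists>y\<in>g. h x \<noteq> h y" if g: "g \<in> E" for g
    using C[OF g]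
  proof
    assume "g \<subseteq> C"
    then show ?thesis using c(2)[OF g] unfolding h_def by (smt (verit) subsetD)
  next
    assume "g \<inter> C = {}"
    then show ?thesis using d(2)[OF g] unfolding h_def by (smt (verit) disjoint_iff)
  qed
  moreover have "\<forall>v. h v \<in> L v" using c(1) d(1) by (auto simp: h_def)
  ultimately show False using not_colourable unfolding colourable_def by blast
qed

section \<open>Closing up longest loose paths\<close>

definition longest :: "'a list \<Rightarrow> bool" where
  "longest xs \<longleftrightarrow> lpath E xs \<and> (\<forall>ys. lpath E ys \<longrightarrow> length ys \<le> length xs)"

lemma edge_obtain:
  assumes "g \<in> E" "x \<in> g"
  obtains s t where "g = {x, s, t}" "s \<noteq> t" "x \<noteq> s" "x \<noteq> t"
  using card_edge[OF assms(1)] assms(2) unfolding card_3_iff by blast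

lemma edge_distinct: "{x, s, t} \<in> E \<Longrightarrow> x \<noteq> s \<and> x \<noteq> t \<and> s \<noteq> t"
  using card_edge[of "{x, s, t}"] by (auto simp: card_insert_if split: if_splits)

lemma longest_exists: "\<exists>a b ys. longest (a # b # ys) \<and> ys \<noteq> []"
proof -
  have fin: "finite (\<Union>E)"
    using finite_E card_edge by (intro finite_Union) (auto intro: card_ge_0_finite)
  \<comment> \<open>The slack covers one-vertex paths, whose vertex may lie in no edge, even before
    \<open>E\<close> is known to be nonempty.\<close>
  have bound: "length xs < card (\<Union>E) + 2" if "lpath E xs" for xs
    using lpath_set_subset[OF that] lpath_distinct[OF that] card_mono[OF fin, of "set xs"]
    by (auto simp: distinct_card)
  have "E \<noteq> {}"
  proof
    assume "E = {}"
    moreover have "\<exists>col. \<forall>v. col v \<in> L v" using card_L by (intro choice) (metis card_2_iff insertCI)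
    ultimately show False using not_colourable unfolding colourable_def by auto
  qed
  then obtain e where e: "e \<in> E" by auto
  then obtain a b c where "e = {a, b, c}" "a \<noteq> b" "b \<noteq> c" "a \<noteq> c"
    using card_edge[OF e] unfolding card_3_iff by blast
  with e have abc: "lpath E [a, b, c]" by auto
  obtain xs where xs: "longest xs"
    using ex_has_greatest_nat[of "lpath E" _ length, OF abc] bound unfolding longest_def by blast
  then have "length [a, b, c] \<le> length xs" using abc unfolding longest_def by blast
  then obtain a b c ys where "xs = a # b # c # ys" by (metis length_ge_3_obtain[of xs] list.size(3,4) numeral_3_eq_3 One_nat_def add.right_neutral add_Suc_right)
  with xs show ?thesis by blast
qed

lemma longest_rev: "longest xs \<Longrightarrow> longest (rev xs)"
  unfolding longest_def using lpath_rev by auto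

text \<open>Separating the two end vertices gives an edge that closes up, as the path cannot be extended.\<close>

lemma longest_end:
  assumes "longest (a # b # ys)"
  obtains c d s t where "{c, d} = {a, b}" "longest (c # d # ys)" "{c, s, t} \<in> E" "s \<in> set ys"
    "t \<notin> set (a # b # ys)"
proof -
  have p: "lpath E (a # b # ys)" using assms unfolding longest_def by blast
  then have "a \<noteq> b" "{a, b, hd ys} \<in> E" by auto
  then obtain g where g: "g \<in> E" "(a \<in> g) \<noteq> (b \<in> g)" using separating_edge[of _ a b] by blast
  obtain c d where cd: "{c, d} = {a, b}" "c \<in> g" "d \<notin> g" using g(2) by blast
  have "c = a \<and> d = b \<or> c = b \<and> d = a" using cd(1) by (auto simp: doubleton_eq_iff)
  then have l: "longest (c # d # ys)"
    using assms p lpath_swap[OF p] unfolding longest_def by auto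
  then have pc: "lpath E (c # d # ys)" unfolding longest_def by blast
  then have "ys \<noteq> []" by auto
  then have ys: "hd ys \<in> set ys" by simp
  obtain s t where st: "g = {c, s, t}" "s \<noteq> t" "c \<noteq> s" "c \<noteq> t" using edge_obtain[OF g(1) cd(2)] .
  have "s \<in> set ys \<or> t \<in> set ys"
  proof (rule ccontr)
    assume "\<not> ?thesis"
    then have "lpath E (s # t # c # d # ys)"
      using pc st cd g(1) by (auto simp: insert_commute)
    then have "length (s # t # c # d # ys) \<le> length (c # d # ys)"
      using l unfolding longest_def by blast
    then show False by simp
  qed
  \<comment> \<open>If both lay on \<open>ys\<close>, then over the path \<open>ys\<close> the edge
    \<open>g\<close> would add only \<open>c\<close>, and the first path edge after it only
    \<open>d\<close>.\<close>
  moreover have "\<not> (s \<in> set ys \<and> t \<in> set ys)"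
  proof
    assume "s \<in> set ys \<and> t \<in> set ys"
    then have "bicyclic E"
      using pc ys g(1) cd(3) st by (intro bicyclicI[of E ys g "{c, d, hd ys}" c d]) auto
    then show False using not_bicyclic by simp
  qed
  ultimately obtain s' t' where "{s', t'} = {s, t}" "s' \<in> set ys" "t' \<notin> set ys" by blast
  moreover from this have "g = {c, s', t'}" using st by auto
  moreover from calculation have "t' \<noteq> d" "t' \<noteq> c" using cd st by auto
  ultimately show ?thesis using that[OF cd(1) l, of s' t'] g(1) cd(1) by auto
qed

text \<open>The edge from \<open>longest_end\<close> closes the path to a loose cycle if it hits one
  of the last two vertices. Otherwise the corresponding edge at the other end, together with this
  one, makes \<open>E\<close> bicyclic.\<close>

lemma loose_cycle_exists:
  "\<exists>zs. loose_cycle E zs \<and> (\<forall>ys. lpath E ys \<longrightarrow> length ys < length zs)"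
proof -
  obtain a\<^sub>0 b\<^sub>0 ys where l0: "longest (a\<^sub>0 # b\<^sub>0 # ys)" using longest_exists by blast
  obtain a b s t where ab: "{a, b} = {a\<^sub>0, b\<^sub>0}" and l: "longest (a # b # ys)"
    and g: "{a, s, t} \<in> E" "s \<in> set ys" "t \<notin> set (a\<^sub>0 # b\<^sub>0 # ys)"
    using longest_end[OF l0] .
  have t: "t \<notin> set (a # b # ys)" using g(3) ab by auto
  have p: "lpath E (a # b # ys)" using l unfolding longest_def by blast
  \<comment> \<open>With \<open>s\<close> as last vertex, \<open>{a, s, t}\<close> is a closing edge
    with \<open>t\<close> in the middle, and the cycle has one vertex more than a longest
    path.\<close>
  have close: ?thesis if q: "lpath E (a # b # xs)" "last xs = s" "t \<notin> set xs" "length xs = length ys" for xs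
  proof -
    have "xs \<noteq> []" using q by auto
    then have "loose_cycle E (t # a # b # xs)"
      unfolding loose_cycle_def using q g t by (cases xs) (auto simp: insert_commute)
    moreover have "\<forall>zs. lpath E zs \<longrightarrow> length zs < length (t # a # b # xs)"
      using l q(4) unfolding longest_def by (auto simp: less_Suc_eq_le)
    ultimately show ?thesis by blast
  qed
  show ?thesis
  proof (cases "s = last ys")
    case True
    then show ?thesis using close[of ys] p t by auto
  next
    case ns: False
    have "odd (length ys)" using p lpath_odd[of E ys] by auto
    moreover have "length ys \<noteq> 1" using ns g(2) by (auto simp: length_Suc_conv)
    ultimately have "3 \<le> length (rev ys)" by (cases "length ys = 2") (auto simp: not_less_eq_eq, presburger)
    then obtain z\<^sub>0 y\<^sub>0 x xs where "rev ys = z\<^sub>0 # y\<^sub>0 # x # xs" by (rule length_ge_3_obtain)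
    then have ys: "ys = rev xs @ [x, y\<^sub>0, z\<^sub>0]" by simp
    define vs where "vs = rev xs @ [x]"
    have ys: "ys = vs @ [y\<^sub>0, z\<^sub>0]" "vs \<noteq> []" by (simp_all add: ys vs_def)
    show ?thesis
    proof (cases "s = y\<^sub>0")
      case True
      have "lpath E (a # b # vs @ [z\<^sub>0, y\<^sub>0])"
        using p lpath_swap_last[of E "a # b # vs" y\<^sub>0 z\<^sub>0] by (simp add: ys)
      then show ?thesis using close[of "vs @ [z\<^sub>0, y\<^sub>0]"] True t by (simp add: ys)
    next
      case False
      \<comment> \<open>So \<open>s\<close> stays on the path even if its far end
        \<open>y\<^sub>0\<close>, \<open>z\<^sub>0\<close> is cut off. Reversing the path gives an
        edge \<open>{z, s', t'}\<close> at that end.\<close>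
      then have s: "s \<in> set vs" using g(2) ns by (auto simp: ys)
      have "longest (z\<^sub>0 # y\<^sub>0 # rev vs @ [b, a])" using longest_rev[OF l] by (simp add: ys)
      then obtain z y s' t' where zy: "{z, y} = {z\<^sub>0, y\<^sub>0}" and l': "longest (z # y # rev vs @ [b, a])"
        and g': "{z, s', t'} \<in> E" "s' \<in> set (rev vs @ [b, a])" "t' \<notin> set (z\<^sub>0 # y\<^sub>0 # rev vs @ [b, a])"
        by (rule longest_end)
      have p': "lpath E (z # y # rev vs @ [b, a])" using l' unfolding longest_def by blast
      have set_ys: "set ys = {z, y} \<union> set vs" using zy by (auto simp: ys)
      have d: "distinct (z # y # rev vs @ [b, a])" using lpath_distinct[OF p'] .
      have ds: "a \<noteq> s" "s \<noteq> t" "z \<noteq> s'" "z \<noteq> t'" "a \<noteq> t" "s' \<noteq> t'"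
        using edge_distinct[OF g(1)] edge_distinct[OF g'(1)] by auto
      have "bicyclic E"
      proof (cases "t = t'")
        case True
        \<comment> \<open>A common new vertex: on the path without \<open>z\<close> and
          \<open>y\<close>, the first edge adds \<open>t\<close> and the second one brings back only
          \<open>z\<close>.\<close>
        show ?thesis
        proof (rule bicyclicI)
          show "lpath E (rev vs @ [b, a])" using p' by simp
          show "{a, s, t} - set (rev vs @ [b, a]) = {t}" using s t by (auto simp: set_ys)
          show "{z, s', t'} - (set (rev vs @ [b, a]) \<union> {a, s, t}) = {z}"
            using g'(2) d True t s by (auto simp: set_ys)
        qed (use g g' in auto)
      next
        case False
        \<comment> \<open>Different new vertices: on the whole path the two edges add
          \<open>t\<close> and \<open>t'\<close> in turn.\<close>
        show ?thesis
        proof (rule bicyclicI)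
          show "lpath E (a # b # ys)" by (rule p)
          show "{a, s, t} - set (a # b # ys) = {t}" using g(2) t by auto
          have "t' \<notin> set (a # b # ys)" using g'(3) by (auto simp: ys)
          then show "{z, s', t'} - (set (a # b # ys) \<union> {a, s, t}) = {t'}"
            using g'(2) False ds s by (auto simp: set_ys)
        qed (use g g' in auto)
      qed
      then show ?thesis using not_bicyclic by simp
    qed
  qed
qed


section \<open>Edges meeting the loose cycle\<close>

lemma loose_cycle_front:
  assumes "loose_cycle E zs" "x \<in> set zs"
  obtains t v w xs where "loose_cycle E (t # v # w # xs)" "set (t # v # w # xs) = set zs"
    "length (t # v # w # xs) = length zs" "x \<in> {t, v}"
proof -
  obtain i where i: "i < length zs" "x = zs ! i" using assms(2) by (auto simp: in_set_conv_nth)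
  \<comment> \<open>Rotations by an even amount preserve the shape of the cycle; this one brings
    position \<open>i\<close> to position \<open>i mod 2\<close>.\<close>
  define ws where "ws = rotate (2 * (i div 2)) zs"
  have c: "loose_cycle E ws" unfolding ws_def using assms(1) by (rule loose_cycle_rotate)
  obtain t v w xs where ws: "ws = t # v # w # xs" using loose_cycle_cases[OF c] by metis
  have "ws ! (i mod 2) = zs ! i"
    unfolding ws_def using i(1) loose_cycle_length[OF assms(1)]
    by (subst nth_rotate) (auto simp: mult_div_mod_eq)
  then have "x \<in> {t, v}"
    using i(2) by (cases "even i") (auto simp: ws odd_iff_mod_2_eq_one)
  then show ?thesis using that[of t v w xs] c ws by (metis ws_def set_rotate length_rotate)
qed

text \<open>If just one vertex of \<open>g\<close> is outside, the cycle without its first vertex is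
  a path to which the closing edge and then \<open>g\<close> add one vertex each. If two are
  outside, the cycle is opened by omitting one vertex so that the path starts at \<open>x\<close>;
  prepending \<open>g\<close> gives a path longer than the cycle.\<close>

lemma edge_inside_cycle:
  assumes c: "loose_cycle E zs" and long: "\<And>ys. lpath E ys \<Longrightarrow> length ys < length zs"
    and g: "g \<in> E" "g \<inter> set zs \<noteq> {}"
  shows "g \<subseteq> set zs"
proof (rule ccontr)
  assume "\<not> g \<subseteq> set zs"
  then obtain t where t: "t \<in> g" "t \<notin> set zs" by blast
  obtain x where x: "x \<in> g" "x \<in> set zs" using g(2) by blast
  obtain p q where "g = {x, p, q}" "x \<noteq> p" "x \<noteq> q" "p \<noteq> q"
    using edge_obtain[OF g(1) x(1)] by metis
  moreover from this have "t = p \<or> t = q" using t x by auto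
  ultimately obtain s where gx: "g = {x, s, t}" "x \<noteq> s" "x \<noteq> t" "s \<noteq> t"
    by (metis insert_commute)
  show False
  proof (cases "s \<in> set zs")
    case True
    obtain h xs where zs: "zs = h # xs" "lpath E xs" "{last xs, h, hd xs} \<in> E" "h \<notin> set xs"
      using c unfolding loose_cycle_def by blast
    have ne: "xs \<noteq> []" using zs(2) by auto
    have "bicyclic E"
    proof (rule bicyclicI)
      show "{last xs, h, hd xs} - set xs = {h}" using zs(4) ne by auto
      show "g - (set xs \<union> {last xs, h, hd xs}) = {t}"
        using gx True x t(2) ne by (auto simp: zs(1))
    qed (use zs g in auto)
    then show False using not_bicyclic by simp
  next
    case False
    obtain p q w xs where pq: "loose_cycle E (p # q # w # xs)" "set (p # q # w # xs) = set zs"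
      "length (p # q # w # xs) = length zs" "x \<in> {p, q}"
      using loose_cycle_front[OF c x(2)] .
    note ys = loose_cycle_ConsD[OF pq(1)]
    then have "lpath E (rev (xs @ [p, q]))" by (intro lpath_rev lpath_snoc) auto
    then have "lpath E (q # p # rev xs)" by simp
    moreover from this have "lpath E (p # q # rev xs)" by (rule lpath_swap)
    ultimately obtain y where y: "lpath E (x # y # rev xs)" "y \<in> {p, q}" using pq(4) by auto
    have "s \<notin> set (x # y # rev xs)" "t \<notin> set (x # y # rev xs)"
      using False t(2) gx y(2) unfolding pq(2)[symmetric] by auto
    with y(1) gx g(1) have "lpath E (s # t # x # y # rev xs)" by (auto simp: insert_commute)
    from long[OF this] show False unfolding pq(3)[symmetric] by simp
  qed
qed

text \<open>Removing three consecutive vertices leaves the loose path \<open>xs\<close>. If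
  \<open>g\<close> brings back exactly one of them, then one of the two cycle edges through
  \<open>v\<close> brings back exactly one more.\<close>

lemma cycle_window:
  assumes c: "loose_cycle E (t # v # w # xs)" and g: "g \<in> E" "g \<subseteq> set (t # v # w # xs)"
  shows "g \<inter> {t, v, w} \<noteq> {y}"
proof
  assume y: "g \<inter> {t, v, w} = {y}"
  note xs = loose_cycle_ConsD[OF c]
  have ends: "hd xs \<in> set xs" "last xs \<in> set xs" using xs(1) by auto
  have gy: "g - set xs = {y}" using y g(2) xs(5) by auto
  from y consider "y = t" | "y = v" | "y = w" by blast
  then have "bicyclic E"
  proof cases
    case 1
    show ?thesis
    proof (rule bicyclicI[OF xs(2) g(1) xs(3) gy])
      show "{last xs, t, v} - (set xs \<union> g) = {v}" using y ends xs(5) 1 by auto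
    qed
  next
    case 2
    show ?thesis
    proof (rule bicyclicI[OF xs(2) g(1) xs(3) gy])
      show "{last xs, t, v} - (set xs \<union> g) = {t}" using y ends xs(5) 2 by auto
    qed
  next
    case 3
    show ?thesis
    proof (rule bicyclicI[OF xs(2) g(1) xs(4) gy])
      show "{v, w, hd xs} - (set xs \<union> g) = {v}" using y ends xs(5) 3 by auto
    qed
  qed
  then show False using not_bicyclic by simp
qed

text \<open>Otherwise \<open>pair_colouring\<close> would colour all of \<open>E\<close>. For a
  loose cycle, whose vertices are distinct, this yields an edge containing none of the consecutive
  pairs.\<close>

lemma not_distinct_if_pairs_covered:
  assumes "\<And>g. g \<in> E \<Longrightarrow> \<exists>i. 2 * i + 1 < length zs \<and> zs ! (2 * i) \<in> g \<and> zs ! (2 * i + 1) \<in> g"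
  shows "\<not> distinct zs"
proof
  assume "distinct zs"
  from pair_colouring[of L, OF card_L this] obtain col where "\<forall>v. col v \<in> L v"
    "\<forall>i. 2 * i + 1 < length zs \<longrightarrow> col (zs ! (2 * i)) \<noteq> col (zs ! (2 * i + 1))" by blast
  with assms have "colourable L E" unfolding colourable_def by meson
  then show False using not_colourable by simp
qed

text \<open>Some edge \<open>g\<close> contains no pair of the cycle. By \<open>cycle_window\<close>
  its presence propagates round the cycle, so \<open>g\<close> takes the first vertex of every pair;
  as \<open>g\<close> has three vertices, the cycle has six.\<close>

lemma inconsistent: False
proof -
  obtain zs where c: "loose_cycle E zs" and long: "\<And>ys. lpath E ys \<Longrightarrow> length ys < length zs"
    using loose_cycle_exists by blast
  define m where "m = length zs div 2"
  have n: "length zs = 2 * m" "2 \<le> m" using loose_cycle_length[OF c] by (auto simp: m_def)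
  have sub: "g \<subseteq> set zs" if "g \<in> E" for g
  proof -
    obtain t xs where e: "{last xs, t, hd xs} \<in> E" "t \<in> set zs"
      using c unfolding loose_cycle_def by auto
    then have "{last xs, t, hd xs} \<subseteq> set zs"
      by (intro edge_inside_cycle[OF c long]) auto
    then show ?thesis
      using connected[of "set zs" _ g] edge_inside_cycle[OF c long] e(1) that by blast
  qed
  \<comment> \<open>\<open>A j\<close> are the middle vertices of the cycle edges and
    \<open>B j\<close> the vertices shared by consecutive edges; reduction modulo \<open>m\<close>
    lets \<open>Suc\<close> run round the cycle.\<close>
  define A B where "A j = zs ! (2 * (j mod m))" and "B j = zs ! (2 * (j mod m) + 1)" for j
  have window: "g \<inter> {A j, B j, A (Suc j)} \<noteq> {y}" if g: "g \<in> E" for g j y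
  proof -
    define ws where "ws = rotate (2 * j) zs"
    have cw: "loose_cycle E ws" unfolding ws_def using c by (rule loose_cycle_rotate)
    then obtain t v w xs where ws: "ws = t # v # w # xs" using loose_cycle_cases by metis
    have nth: "ws ! i = zs ! ((2 * j + i) mod (2 * m))" if "i < 2 * m" for i
      unfolding ws_def using that n by (simp add: nth_rotate)
    have "Suc (2 * j) mod (2 * m) = Suc (2 * (j mod m))" 
      using n(2) by (metis Suc_double_not_eq_double mod_Suc mult_mod_right)
    then have "A j = t" "B j = v" "A (Suc j) = w"
      using nth[of 0] nth[of 1] nth[of 2] n(2)
      by (simp_all add: ws A_def B_def mult_mod_right eval_nat_numeral)
    then show ?thesis
      using cycle_window[of t v w xs g y] cw sub[OF g] g by (simp add: ws ws_def flip: ws) 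
  qed
  have "\<exists>g\<in>E. \<forall>i<m. \<not> (zs ! (2 * i) \<in> g \<and> zs ! (2 * i + 1) \<in> g)"
  proof (rule ccontr)
    assume "\<not> ?thesis"
    then have "\<exists>i<m. zs ! (2 * i) \<in> g \<and> zs ! (2 * i + 1) \<in> g" if "g \<in> E" for g
      using that by blast
    moreover have "2 * i + 1 < length zs" if "i < m" for i using that n(1) by simp
    ultimately have "\<exists>i. 2 * i + 1 < length zs \<and> zs ! (2 * i) \<in> g \<and> zs ! (2 * i + 1) \<in> g"
      if "g \<in> E" for g
      using that by meson
    then show False using not_distinct_if_pairs_covered[of zs] loose_cycle_distinct[OF c] by blast
  qed
  then obtain g where g: "g \<in> E" "\<And>i. i < m \<Longrightarrow> \<not> (zs ! (2 * i) \<in> g \<and> zs ! (2 * i + 1) \<in> g)"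
    by blast
  have AB: "\<not> (A j \<in> g \<and> B j \<in> g)" for j unfolding A_def B_def using n by (intro g(2)) simp
  \<comment> \<open>Exactly one of \<open>A j\<close>, \<open>B j\<close> is in \<open>g\<close>,
    and \<open>g\<close> cannot meet the window in a single vertex.\<close>
  have next_A: "A (Suc j) \<in> g" if "A j \<in> g \<or> B j \<in> g" for j
    using that AB[of j] window[OF g(1), of j "A j"] window[OF g(1), of j "B j"] by blast
  have index: "\<exists>j<m. x = A j \<or> x = B j" if "x \<in> set zs" for x
  proof -
    obtain i where i: "i < 2 * m" "x = zs ! i" using \<open>x \<in> set zs\<close> n by (auto simp: in_set_conv_nth)
    then have "i div 2 < m" by simp
    moreover from this have "x = A (i div 2) \<or> x = B (i div 2)"
      unfolding A_def B_def i(2) by (cases "even i") (auto elim: oddE)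
    ultimately show ?thesis by blast
  qed
  have "g \<noteq> {}" using card_edge[OF g(1)] by auto
  then obtain i where "A i \<in> g \<or> B i \<in> g" using sub[OF g(1)] index by blast
  then have "A (Suc i) \<in> g" by (rule next_A)
  then have A_add: "A (Suc i + k) \<in> g" for k
    by (induction k) (use next_A in auto)
  have A_mem: "A j \<in> g" for j
  proof -
    \<comment> \<open>\<open>A_add\<close> reaches only indices beyond \<open>i\<close>; adding full
      rounds brings every index into that range.\<close>
    have "A j = A (j + m * Suc i)" by (simp add: A_def del: mult_Suc_right)
    moreover have "j + m * Suc i = Suc i + (j + (m - 1) * Suc i)"
      using n(2) by (cases m) auto
    ultimately show ?thesis using A_add by metis
  qed
  have B_mem: "B j \<notin> g" for j using AB A_mem by blast
  have g_eq: "g = A ` {..<m}"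
    using sub[OF g(1)] index A_mem B_mem by blast
  have "inj_on A {..<m}"
    using loose_cycle_distinct[OF c] n by (auto simp: inj_on_def A_def nth_eq_iff_index_eq)
  \<comment> \<open>Colouring the pairs \<open>A j\<close>, \<open>B j\<close> differently can only fail for the Pasch configuration.\<close>
  then have "m = 3" using card_edge[OF g(1)] by (simp add: g_eq card_image)
  then have "length zs = 6" using n by simp
  then obtain t v w x y z where zs: "zs = [t, v, w, x, y, z]"
    by (auto simp: length_Suc_conv eval_nat_numeral)
  have ABs: "A 0 = t" "B 0 = v" "A 1 = w" "B 1 = x" "A 2 = y" "B 2 = z" "A 3 = t"
    by (simp_all add: A_def B_def \<open>m = 3\<close> zs)
  have d: "distinct zs" using loose_cycle_distinct[OF c] .
  have L: "\<exists>b. b \<in> L u \<and> b \<noteq> a" for u a using card_2_obtain_neq[OF card_L] by metis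
  obtain cc where cc: "\<And>u a. cc u a \<in> L u" "\<And>u a. cc u a \<noteq> a" using L by metis
  \<comment> \<open>\<open>cc u a\<close> is a colour from the list of \<open>u\<close> other than
    \<open>a\<close>, and 0 is an arbitrary colour to avoid. Separating \<open>w\<close> from
    \<open>t\<close> splits \<open>g = {t, w, y}\<close>; the pair \<open>w\<close>,
    \<open>x\<close> is given up, and \<open>x\<close> is separated from \<open>v\<close>
    instead.\<close>
  define col where "col = (\<lambda>u. cc u 0)(t := cc t 0, v := cc v (cc t 0), w := cc w (cc t 0),
    x := cc x (cc v (cc t 0)), y := cc y 0, z := cc z (cc y 0))"
  have col: "col v \<noteq> col t" "col w \<noteq> col t" "col x \<noteq> col v" "col z \<noteq> col y"
    using d cc(2) by (auto simp: col_def zs)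
  have "\<exists>a\<in>h. \<exists>b\<in>h. col a \<noteq> col b" if h: "h \<in> E" for h
  proof (rule ccontr)
    assume "\<not> ?thesis"
    then have eq: "a \<in> h \<Longrightarrow> b \<in> h \<Longrightarrow> col a = col b" for a b by blast
    have W: "h \<inter> {t, v, w} \<noteq> {u}" "h \<inter> {w, x, y} \<noteq> {u}" "h \<inter> {y, z, t} \<noteq> {u}" for u
      using window[OF h, of 0 u] window[OF h, of 1 u] window[OF h, of 2 u] ABs
      by (simp_all add: eval_nat_numeral)
    have P: "\<not> (v \<in> h \<and> t \<in> h)" "\<not> (w \<in> h \<and> t \<in> h)" "\<not> (x \<in> h \<and> v \<in> h)" "\<not> (z \<in> h \<and> y \<in> h)"
      using eq col by metis+
    \<comment> \<open>The windows and the separated pairs exclude one vertex after another from a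
      monochromatic edge, until only \<open>v\<close> and \<open>w\<close> remain.\<close>
    have "t \<notin> h" using W(1)[of t] P by blast
    moreover from this have "y \<notin> h" "z \<notin> h" using W(3)[of y] W(3)[of z] P by blast+
    moreover from calculation have "x \<notin> h" using W(1)[of v] W(1)[of w] W(2)[of x] P by blast
    ultimately have "h \<subseteq> {v, w}" using sub[OF h] by (auto simp: zs)
    then have "card h \<le> card {v, w}" by (intro card_mono) auto
    also have "\<dots> \<le> 2" by (simp add: card_insert_if)
    finally show False using card_edge[OF h] by simp
  qed
  moreover have "col u \<in> L u" for u using cc(1) by (auto simp: col_def)
  ultimately show False using not_colourable unfolding colourable_def by blast
qed

end

text \<open>Subsets of a non-bicyclic edge set are not bicyclic either, so induction over proper
  subsets turns a counterexample into a \<open>critical_hypergraph\<close>.\<close>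

lemma colourable_if_not_bicyclic:
  assumes "finite E" "\<And>e. e \<in> E \<Longrightarrow> card e = 3" "\<And>v. card (L v) = 2" "\<not> bicyclic E"
  shows "colourable L E"
  using assms(1,2,4)
proof (induction E rule: finite_psubset_induct)
  case (psubset E)
  show ?case
  proof (rule ccontr)
    assume "\<not> colourable L E"
    moreover have "colourable L F" if "F \<subset> E" for F
    proof (intro psubset.IH[OF that])
      show "\<not> bicyclic F" using bicyclic_mono[of F E] that psubset.prems(2) by blast
    qed (use that psubset.prems(1) in blast)
    ultimately have "critical_hypergraph E L"
      using psubset.hyps psubset.prems assms(3) unfolding critical_hypergraph_def by blast
    then show False by (rule critical_hypergraph.inconsistent)
  qed
qed

section \<open>Two-fold closed paths in a random subset\<close>

lemma prob_random_subset_superset: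
  assumes "finite X" "S \<subseteq> X" "0 \<le> p" "p \<le> 1"
  shows "measure_pmf.prob (random_subset X p) {Y. S \<subseteq> Y} = p ^ card S"
proof -
  have "measure_pmf.prob (random_subset X p) {Y. S \<subseteq> Y} =
      measure_pmf.prob (Pi_pmf X False (\<lambda>_. bernoulli_pmf p)) {f. \<forall>x\<in>S. f x}"
    unfolding random_subset_def measure_map_pmf using assms(2)
    by (intro arg_cong2[where f = measure]) auto
  also have "{f. \<forall>x\<in>S. f x} = Pi X (\<lambda>x. if x \<in> S then {True} else UNIV)"
    using assms(2) by (auto simp: Pi_iff split: if_splits)
  also have "measure_pmf.prob (Pi_pmf X False (\<lambda>_. bernoulli_pmf p)) \<dots> =
      (\<Prod>x\<in>X. if x \<in> S then p else 1)"
    using assms by (subst measure_Pi_pmf_Pi) (auto intro!: prod.cong simp: measure_pmf_single)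
  also have "\<dots> = p ^ card S"
    using assms by (simp add: prod.If_cases Int_absorb1)
  finally show ?thesis .
qed

lemma card_UN_bound:
  assumes "finite I" "\<And>i. i \<in> I \<Longrightarrow> card (A i) \<le> b"
  shows "card (\<Union>i\<in>I. A i) \<le> card I * b"
proof -
  have "card (\<Union>i\<in>I. A i) \<le> (\<Sum>i\<in>I. card (A i))" using assms(1) by (rule card_UN_le)
  also have "\<dots> \<le> card I * b" using sum_bounded_above[of I "\<lambda>i. card (A i)" b] assms(2) by simp
  finally show ?thesis .
qed

locale triple_system =
  fixes X :: "'a set" and E :: "'a set set"
  assumes finite_X: "finite X"
    and edge_subset: "e \<in> E \<Longrightarrow> e \<subseteq> X"
    and card_edge: "e \<in> E \<Longrightarrow> card e = 3"
    and codegree: "card {w. {u, v, w} \<in> E} \<le> 3"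
begin

section \<open>Counting loose paths and their extensions\<close>

definition paths :: "nat \<Rightarrow> 'a list set" where
  "paths k = {xs. lpath E xs \<and> set xs \<subseteq> X \<and> length xs = 2 * k + 1}"

definition extensions :: "'a list \<Rightarrow> 'a list set" where
  "extensions xs = (\<Union>u\<in>set xs. \<Union>v\<in>set xs. (\<lambda>w. w # xs) ` {w. {u, v, w} \<in> E})"

lemma finite_codegree: "finite {w. {u, v, w} \<in> E}"
  using edge_subset by (intro finite_subset[OF _ finite_X]) blast

lemma finite_paths: "finite (paths k)"
  using finite_X by (intro finite_subset[OF _ finite_lists_length_eq[of X "2 * k + 1"]])
    (auto simp: paths_def)

lemma card_codegree_image: "card ((\<lambda>w. f w) ` {w. {u, v, w} \<in> E}) \<le> 3"
  using card_image_le[OF finite_codegree, of f u v] codegree[of u v] by linarith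

text \<open>Each further edge costs a free choice of \<open>a\<close> in \<open>X\<close> and, by
  the codegree condition with \<open>hd ys\<close> and \<open>a\<close>, at most three choices of
  \<open>b\<close>.\<close>

lemma card_paths: "card (paths k) \<le> card X * (3 * card X) ^ k"
proof (induction k)
  case 0
  have "paths 0 \<subseteq> (\<lambda>x. [x]) ` X" by (auto simp: paths_def length_Suc_conv)
  then show ?case using card_mono[of "(\<lambda>x. [x]) ` X"] card_image_le[OF finite_X] finite_X
    by (metis finite_imageI le_trans mult.right_neutral power_0)
next
  case (Suc k)
  have "xs \<in> (\<Union>ys\<in>paths k. \<Union>a\<in>X. (\<lambda>b. a # b # ys) ` {b. {a, hd ys, b} \<in> E})"
    if xs: "xs \<in> paths (Suc k)" for xs
  proof -
    obtain a b ys where "xs = a # b # ys" using xs by (auto simp: paths_def length_Suc_conv)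
    then show ?thesis using xs by (auto simp: paths_def insert_commute)
  qed
  then have "card (paths (Suc k)) \<le>
      card (\<Union>ys\<in>paths k. \<Union>a\<in>X. (\<lambda>b. a # b # ys) ` {b. {a, hd ys, b} \<in> E})"
    using finite_paths finite_X finite_codegree by (intro card_mono) auto
  also have "\<dots> \<le> card (paths k) * (card X * 3)"
    by (intro card_UN_bound finite_paths finite_X card_codegree_image)
  also have "\<dots> \<le> (card X * (3 * card X) ^ k) * (card X * 3)"
    using Suc by (rule mult_right_mono) simp
  finally show ?case by (simp add: algebra_simps)
qed

lemma finite_extensions: "finite (extensions xs)"
  unfolding extensions_def using finite_codegree by auto

lemma length_extensions: "ys \<in> extensions xs \<Longrightarrow> length ys = Suc (length xs)"
  unfolding extensions_def by (elim UN_E imageE) simp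

lemma card_extensions: "card (extensions xs) \<le> 3 * length xs ^ 2"
proof -
  have "card (extensions xs) \<le> card (set xs) * (card (set xs) * 3)"
    unfolding extensions_def by (intro card_UN_bound card_codegree_image) auto
  also have "\<dots> \<le> length xs * (length xs * 3)"
    by (intro mult_mono card_length) auto
  finally show ?thesis by (simp add: power2_eq_square algebra_simps)
qed

text \<open>Vertex lists of the configurations in \<open>bicyclic\<close> whose path has
  \<open>k\<close> edges, with the two added vertices in front. Distinctness fixes the number of
  vertices and hence the probability that all are retained.\<close>

definition witnesses :: "nat \<Rightarrow> 'a list set" where
  "witnesses k = {zs \<in> (\<Union>xs\<in>paths k. \<Union>ys\<in>extensions xs. extensions ys). distinct zs \<and> set zs \<subseteq> X}"

lemma finite_witnesses: "finite (witnesses k)"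
  unfolding witnesses_def using finite_paths finite_extensions by auto

lemma card_witnesses: "card (witnesses k) \<le> 144 * card X * (48 * card X) ^ k"
proof -
  have "card (witnesses k) \<le> card (\<Union>xs\<in>paths k. \<Union>ys\<in>extensions xs. extensions ys)"
    unfolding witnesses_def using finite_paths finite_extensions by (intro card_mono) auto
  also have "\<dots> \<le> card (paths k) * ((3 * (2 * k + 1) ^ 2) * (3 * (2 * k + 2) ^ 2))"
  proof (intro card_UN_bound finite_paths)
    fix xs assume "xs \<in> paths k"
    then have xs: "length xs = 2 * k + 1" by (simp add: paths_def)
    have "card (\<Union>ys\<in>extensions xs. extensions ys) \<le> card (extensions xs) * (3 * (2 * k + 2) ^ 2)"
      using card_extensions length_extensions[of _ xs] xs
      by (intro card_UN_bound finite_extensions) (metis Suc_1 add_Suc_right add.right_neutral One_nat_def)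
    also have "\<dots> \<le> (3 * (2 * k + 1) ^ 2) * (3 * (2 * k + 2) ^ 2)"
      using card_extensions[of xs] xs by (intro mult_right_mono) simp_all
    finally show "card (\<Union>ys\<in>extensions xs. extensions ys) \<le>
      (3 * (2 * k + 1) ^ 2) * (3 * (2 * k + 2) ^ 2)" .
  qed
  \<comment> \<open>The factor polynomial in \<open>k\<close> is at most
    \<open>9 * (2 * 2 ^ k) ^ 4 = 144 * 16 ^ k\<close>; the power of 16 then turns
    \<open>3 * card X\<close> into \<open>48 * card X\<close>.\<close>
  also have "\<dots> \<le> (card X * (3 * card X) ^ k) * (144 * 16 ^ k)"
  proof (rule mult_le_mono[OF card_paths])
    have k: "2 * k + 2 \<le> 2 * 2 ^ k" using less_exp[of k] by linarith
    have "(3 * (2 * k + 1) ^ 2) * (3 * (2 * k + 2) ^ 2) \<le> (3 * (2 * 2 ^ k) ^ 2) * (3 * (2 * 2 ^ k) ^ 2)"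
      using k by (intro mult_le_mono power_mono order_refl) simp_all
    also have "\<dots> = 144 * (2 ^ k) ^ 4" by (simp add: power2_eq_square power4_eq_xxxx)
    also have "\<dots> = 144 * (2 ^ 4) ^ k" by (simp only: power_mult[symmetric] mult.commute)
    finally show "(3 * (2 * k + 1) ^ 2) * (3 * (2 * k + 2) ^ 2) \<le> 144 * 16 ^ k" by simp
  qed
  also have "\<dots> = 144 * card X * ((3 * card X) ^ k * 16 ^ k)" by (simp only: mult_ac)
  also have "(3 * card X) ^ k * 16 ^ k = (48 * card X) ^ k"
  proof -
    have "48 * card X = 3 * card X * 16" by simp
    then show ?thesis by (simp only: power_mult_distrib)
  qed
  finally show ?thesis .
qed

lemma length_witnesses: "zs \<in> witnesses k \<Longrightarrow> length zs = 2 * k + 3"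
  unfolding witnesses_def paths_def by (elim CollectE conjE UN_E) (simp add: length_extensions)

lemma bicyclic_witness:
  assumes Y: "Y \<subseteq> X" and b: "bicyclic {e \<in> E. e \<subseteq> Y}"
  shows "\<exists>k<card X. \<exists>zs\<in>witnesses k. set zs \<subseteq> Y"
proof -
  obtain xs f g y z where p: "lpath {e \<in> E. e \<subseteq> Y} xs" and f: "f \<in> E" "f \<subseteq> Y"
    and g: "g \<in> E" "g \<subseteq> Y" and y: "f - set xs = {y}" and z: "g - (set xs \<union> f) = {z}"
    using b unfolding bicyclic_def by blast
  have third: "\<exists>u v. u \<noteq> v \<and> u \<noteq> w \<and> v \<noteq> w \<and> e = {u, v, w}" if "e \<in> E" "w \<in> e" for e w
    using card_edge[OF that(1)] that(2) unfolding card_3_iff by blast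
  have yz: "y \<in> f" "y \<notin> set xs" "z \<in> g" "z \<notin> set xs" "z \<notin> f" using y z by auto
  obtain u v where uv: "u \<noteq> v" "u \<noteq> y" "v \<noteq> y" "f = {u, v, y}"
    using third[OF f(1) yz(1)] by metis
  obtain u' v' where uv': "u' \<noteq> z" "v' \<noteq> z" "g = {u', v', z}"
    using third[OF g(1) yz(3)] by metis
  have mem: "u \<in> set xs" "v \<in> set xs" using y uv by auto
  have "g \<subseteq> insert z (set xs \<union> f)" using z by blast
  then have mem': "u' \<in> set (y # xs)" "v' \<in> set (y # xs)" using mem uv(4) uv' by auto
  \<comment> \<open>Two vertices of \<open>f\<close> lie on the path, so it has an edge, which
    forces all its vertices into \<open>Y\<close>.\<close>
  have "length xs \<noteq> 1" using mem uv(1) by (auto simp: length_Suc_conv)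
  then have xs: "set xs \<subseteq> Y" using lpath_set_subset[OF p] by blast
  obtain k where k: "length xs = 2 * k + 1" using lpath_odd[OF p] by (auto elim: oddE)
  have "lpath E xs" using p by (rule lpath_mono) auto
  then have "xs \<in> paths k" using xs Y k by (auto simp: paths_def)
  moreover have "y # xs \<in> extensions xs" using mem uv f unfolding extensions_def by blast
  moreover have "z # y # xs \<in> extensions (y # xs)" using mem' uv' g unfolding extensions_def by blast
  moreover have d: "distinct (z # y # xs)" using lpath_distinct[OF p] yz by auto
  moreover have s: "set (z # y # xs) \<subseteq> Y" using xs f(2) g(2) yz by auto
  ultimately have w: "z # y # xs \<in> witnesses k" using Y unfolding witnesses_def by blast
  \<comment> \<open>The \<open>2 * k + 3\<close> distinct vertices fit into \<open>X\<close>, so the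
    union bound is a finite sum over \<open>k\<close>.\<close>
  have "length (z # y # xs) \<le> card X"
    using card_mono[OF finite_X subset_trans[OF s Y]] distinct_card[OF d] by metis
  then have "k < card X" using k by simp
  then show ?thesis using w s by blast
qed

text \<open>With N = |X|, the union bound for \<open>k\<close> gives at most 144 N (48 N)^k p^(2k+3)
  = 144 (N p^2) p (48 N p^2)^k. As 48/100 \<le> 1/2, the sum over \<open>k\<close> is dominated by a
  geometric series with total 2.88 p.\<close>

lemma prob_bicyclic_le:
  assumes p: "0 \<le> p" "p \<le> 1" and small: "real (card X) * p\<^sup>2 \<le> 1 / 100"
  shows "measure_pmf.prob (random_subset X p) {Y. Y \<subseteq> X \<and> bicyclic {e \<in> E. e \<subseteq> Y}} \<le> 3 * p"
proof -
  let ?P = "measure_pmf.prob (random_subset X p)" and ?N = "real (card X)"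
  have "?P {Y. Y \<subseteq> X \<and> bicyclic {e \<in> E. e \<subseteq> Y}} \<le>
      ?P (\<Union>k<card X. \<Union>zs\<in>witnesses k. {Y. set zs \<subseteq> Y})"
  proof (intro measure_pmf.finite_measure_mono subsetI)
    fix Y assume "Y \<in> {Y. Y \<subseteq> X \<and> bicyclic {e \<in> E. e \<subseteq> Y}}"
    then obtain k zs where "k < card X" "zs \<in> witnesses k" "set zs \<subseteq> Y"
      using bicyclic_witness[of Y] by blast
    then show "Y \<in> (\<Union>k<card X. \<Union>zs\<in>witnesses k. {Y. set zs \<subseteq> Y})" by blast
  qed simp
  also have "\<dots> \<le> (\<Sum>k<card X. ?P (\<Union>zs\<in>witnesses k. {Y. set zs \<subseteq> Y}))"
    by (intro measure_pmf.finite_measure_subadditive_finite) auto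
  also have "\<dots> \<le> (\<Sum>k<card X. \<Sum>zs\<in>witnesses k. ?P {Y. set zs \<subseteq> Y})"
    using finite_witnesses by (intro sum_mono measure_pmf.finite_measure_subadditive_finite) auto
  also have "\<dots> = (\<Sum>k<card X. \<Sum>zs\<in>witnesses k. p ^ (2 * k + 3))"
  proof (intro sum.cong refl)
    fix k zs assume zs: "zs \<in> witnesses k"
    then have "set zs \<subseteq> X" "card (set zs) = 2 * k + 3"
      using length_witnesses[OF zs] by (auto simp: witnesses_def distinct_card)
    then show "?P {Y. set zs \<subseteq> Y} = p ^ (2 * k + 3)"
      using prob_random_subset_superset[OF finite_X _ p] by simp
  qed
  also have "\<dots> = (\<Sum>k<card X. real (card (witnesses k)) * p ^ (2 * k + 3))" by simp
  also have "\<dots> \<le> (\<Sum>k<card X. (144 / 100 * p) * (1 / 2) ^ k)"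
  proof (intro sum_mono)
    fix k
    have "real (card (witnesses k)) \<le> 144 * ?N * (48 * ?N) ^ k"
      using card_witnesses[of k] by (simp flip: of_nat_le_iff[where 'a = real])
    then have "real (card (witnesses k)) * p ^ (2 * k + 3) \<le> (144 * ?N * (48 * ?N) ^ k) * p ^ (2 * k + 3)"
      using p by (intro mult_right_mono) auto
    also have "\<dots> = (144 * (?N * p\<^sup>2) * p) * (48 * (?N * p\<^sup>2)) ^ k"
      by (simp add: power_mult_distrib power_add power_mult power2_eq_square power3_eq_cube algebra_simps)
    also have "\<dots> \<le> (144 * (1 / 100) * p) * (1 / 2) ^ k"
      using small p by (intro mult_mono power_mono) auto
    finally show "real (card (witnesses k)) * p ^ (2 * k + 3) \<le> (144 / 100 * p) * (1 / 2) ^ k" by simp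
  qed
  also have "\<dots> = (144 / 100 * p) * (\<Sum>k<card X. (1 / 2) ^ k)" by (simp add: sum_distrib_left)
  also have "\<dots> \<le> (144 / 100 * p) * 2"
  proof -
    have "(\<Sum>k<card X. (1 / 2) ^ k) \<le> (\<Sum>k. (1 / 2 :: real) ^ k)"
      by (intro sum_le_suminf) (auto intro: summable_geometric)
    also have "\<dots> = 2" by (subst suminf_geometric) auto
    finally show ?thesis using p by (intro mult_left_mono) auto
  qed
  also have "\<dots> \<le> 3 * p" using p by simp
  finally show ?thesis .
qed

end

section \<open>Schur triples\<close>

definition schur_triples :: "('a, 'b) monoid_scheme \<Rightarrow> 'a set \<Rightarrow> 'a set set" where
  "schur_triples G X = {{a, b, a \<otimes>\<^bsub>G\<^esub> b} | a b. a \<in> X \<and> b \<in> X \<and> a \<otimes>\<^bsub>G\<^esub> b \<in> X \<and>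
    a \<noteq> b \<and> a \<noteq> a \<otimes>\<^bsub>G\<^esub> b \<and> b \<noteq> a \<otimes>\<^bsub>G\<^esub> b}"

text \<open>Two elements of a Schur triple leave three candidates for the third: their sum and their
  two differences.\<close>

lemma triple_system_schur_triples:
  assumes "comm_group G" "finite X" "X \<subseteq> carrier G"
  shows "triple_system X (schur_triples G X)"
proof
  interpret comm_group G by fact
  show "finite X" by fact
  show "e \<subseteq> X" if "e \<in> schur_triples G X" for e
    using that by (auto simp: schur_triples_def)
  show card3: "card e = 3" if "e \<in> schur_triples G X" for e
    using that by (auto simp: schur_triples_def)
  show "card {w. {u, v, w} \<in> schur_triples G X} \<le> 3" for u v
  proof -
    have "w \<in> {u \<otimes>\<^bsub>G\<^esub> v, u \<otimes>\<^bsub>G\<^esub> inv\<^bsub>G\<^esub> v, v \<otimes>\<^bsub>G\<^esub> inv\<^bsub>G\<^esub> u}"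
      if w: "{u, v, w} \<in> schur_triples G X" for w
    proof -
      obtain a b where ab: "{u, v, w} = {a, b, a \<otimes>\<^bsub>G\<^esub> b}" "a \<in> carrier G" "b \<in> carrier G"
        "a \<noteq> b" "a \<noteq> a \<otimes>\<^bsub>G\<^esub> b" "b \<noteq> a \<otimes>\<^bsub>G\<^esub> b"
        using w assms(3) unfolding schur_triples_def by blast
      have "card {u, v, w} = 3" using card3[OF w] .
      then have "u \<noteq> v" "u \<noteq> w" "v \<noteq> w" by (auto simp: card_insert_if split: if_splits)
      with ab(1) consider "u = a" "v = b" "w = a \<otimes>\<^bsub>G\<^esub> b" | "u = b" "v = a" "w = a \<otimes>\<^bsub>G\<^esub> b"
        | "w = a" "u = b" "v = a \<otimes>\<^bsub>G\<^esub> b" | "w = a" "v = b" "u = a \<otimes>\<^bsub>G\<^esub> b"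
        | "w = b" "u = a" "v = a \<otimes>\<^bsub>G\<^esub> b" | "w = b" "v = a" "u = a \<otimes>\<^bsub>G\<^esub> b"
        by (smt (verit) insert_iff empty_iff)
      moreover have "(a \<otimes>\<^bsub>G\<^esub> b) \<otimes>\<^bsub>G\<^esub> inv\<^bsub>G\<^esub> b = a" "(a \<otimes>\<^bsub>G\<^esub> b) \<otimes>\<^bsub>G\<^esub> inv\<^bsub>G\<^esub> a = b"
        using ab(2,3) by (simp add: m_assoc, metis inv_closed m_assoc m_comm r_inv r_one)
      ultimately show ?thesis using ab(2,3) m_comm[of a b] by cases simp_all
    qed
    then have "card {w. {u, v, w} \<in> schur_triples G X} \<le>
        card {u \<otimes>\<^bsub>G\<^esub> v, u \<otimes>\<^bsub>G\<^esub> inv\<^bsub>G\<^esub> v, v \<otimes>\<^bsub>G\<^esub> inv\<^bsub>G\<^esub> u}"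
      by (intro card_mono) auto
    also have "\<dots> \<le> 3" by (simp add: card_insert_if)
    finally show ?thesis .
  qed
qed

lemma list_schur_imp_bicyclic:
  assumes G: "comm_group G" and X: "finite X" "X \<subseteq> carrier G" and Y: "Y \<subseteq> X"
    and schur: "list_schur G Y"
  shows "bicyclic {e \<in> schur_triples G X. e \<subseteq> Y}"
proof (rule ccontr)
  assume nb: "\<not> ?thesis"
  interpret triple_system X "schur_triples G X"
    using triple_system_schur_triples[OF G X] .
  obtain L :: "'a \<Rightarrow> nat set" where L: "\<forall>y\<in>Y. card (L y) = 2"
    and mono: "\<And>col. \<forall>y\<in>Y. col y \<in> L y \<Longrightarrow> \<exists>a\<in>Y. \<exists>b\<in>Y. \<exists>c\<in>Y. a \<noteq> b \<and> a \<noteq> c \<and> b \<noteq> c \<and>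
      col a = col b \<and> col b = col c \<and> a \<otimes>\<^bsub>G\<^esub> b = c"
    using schur unfolding list_schur_def by blast
  \<comment> \<open>\<open>colourable\<close> wants a list of size two at every element of the type,
    so elements outside \<open>Y\<close> receive an arbitrary one.\<close>
  define L' where "L' v = (if v \<in> Y then L v else {0, 1})" for v
  have "finite (schur_triples G X)"
    using edge_subset by (intro finite_subset[OF _ finite_Pow_iff[THEN iffD2, OF finite_X]]) blast
  then have "colourable L' {e \<in> schur_triples G X. e \<subseteq> Y}"
  proof (intro colourable_if_not_bicyclic)
    show "card (L' v) = 2" for v
      using L by (cases "v \<in> Y") (simp_all add: L'_def)
  qed (use nb card_edge in auto)
  then obtain col where col: "\<forall>v. col v \<in> L' v"
    "\<And>e. e \<in> schur_triples G X \<Longrightarrow> e \<subseteq> Y \<Longrightarrow> \<exists>u\<in>e. \<exists>v\<in>e. col u \<noteq> col v"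
    unfolding colourable_def by blast
  have "\<forall>y\<in>Y. col y \<in> L y" using col(1) unfolding L'_def by metis
  from mono[OF this] obtain a b c where abc: "a \<in> Y" "b \<in> Y" "c \<in> Y" "a \<noteq> b" "a \<noteq> c" "b \<noteq> c"
    "col a = col b" "col b = col c" "a \<otimes>\<^bsub>G\<^esub> b = c"
    by blast
  then have "{a, b, c} \<in> schur_triples G X" using Y
    unfolding schur_triples_def by (intro CollectI exI[of _ a] exI[of _ b]) auto
  from col(2)[OF this] abc show False by auto
qed

lemma set_random_subset: "finite X \<Longrightarrow> Y \<in> set_pmf (random_subset X p) \<Longrightarrow> Y \<subseteq> X"
  unfolding random_subset_def set_map_pmf by blast

lemma prob_list_schur_le:
  assumes "comm_group G" "finite X" "X \<subseteq> carrier G" "0 \<le> p" "p \<le> 1"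
    "real (card X) * p\<^sup>2 \<le> 1 / 100"
  shows "measure_pmf.prob (random_subset X p) {Y. list_schur G Y} \<le> 3 * p"
proof -
  interpret triple_system X "schur_triples G X"
    using triple_system_schur_triples assms by blast
  have "measure_pmf.prob (random_subset X p) {Y. list_schur G Y} =
      measure_pmf.prob (random_subset X p) {Y. Y \<subseteq> X \<and> list_schur G Y}"
    using set_random_subset[OF assms(2)] by (intro measure_prob_cong_0) (auto simp: set_pmf_eq)
  also have "\<dots> \<le> measure_pmf.prob (random_subset X p)
      {Y. Y \<subseteq> X \<and> bicyclic {e \<in> schur_triples G X. e \<subseteq> Y}}"
    using list_schur_imp_bicyclic[OF assms(1-3)]
    by (intro measure_pmf.finite_measure_mono) auto
  also have "\<dots> \<le> 3 * p" using assms by (intro prob_bicyclic_le)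
  finally show ?thesis .
qed

text \<open>The constant 1/10 makes |X| p^2 \<le> 1/100, as \<open>prob_list_schur_le\<close>
  demands; its bound 3 p tends to 0 because |X| tends to infinity.\<close>

lemma not_list_schur_whp_one_tenth: "not_list_schur_whp TYPE('a) (1 / 10)"
  unfolding not_list_schur_whp_def
proof (intro allI impI)
  fix G :: "nat \<Rightarrow> 'a monoid" and X :: "nat \<Rightarrow> 'a set" and p :: "nat \<Rightarrow> real"
  assume G: "\<forall>n. comm_group (G n)" and X: "\<forall>n. finite (X n) \<and> X n \<subseteq> carrier (G n)"
    and lim: "filterlim (\<lambda>n. card (X n)) at_top sequentially"
    and p01: "\<forall>n. 0 \<le> p n \<and> p n \<le> 1"
    and p: "\<forall>n. X n \<noteq> {} \<longrightarrow> p n \<le> 1 / 10 * real (card (X n)) powr (- 1 / 2)"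
  let ?N = "\<lambda>n. real (card (X n))"
  have N: "filterlim ?N at_top sequentially"
    using filterlim_compose[OF filterlim_real_sequentially lim] .
  have "((\<lambda>x::real. x powr (- 1 / 2)) \<longlongrightarrow> 0) at_top"
    by (intro tendsto_neg_powr filterlim_ident) simp
  from filterlim_compose[OF this N]
  have "(\<lambda>n. 3 * (1 / 10 * ?N n powr (- 1 / 2))) \<longlonglongrightarrow> 3 * (1 / 10 * 0)"
    by (intro tendsto_intros)
  then have bound: "(\<lambda>n. 3 * (1 / 10 * ?N n powr (- 1 / 2))) \<longlonglongrightarrow> 0" by simp
  \<comment> \<open>Nonempty \<open>X n\<close> is what makes the bound on \<open>p n\<close>
    available and lets |X| cancel against its inverse.\<close>
  have "\<forall>\<^sub>F n in sequentially. 1 \<le> card (X n)"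
    using lim by (simp add: filterlim_at_top)
  then have "\<forall>\<^sub>F n in sequentially.
      measure_pmf.prob (random_subset (X n) (p n)) {Y. list_schur (G n) Y} \<le>
        3 * (1 / 10 * ?N n powr (- 1 / 2))"
  proof eventually_elim
    case (elim n)
    then have ne: "X n \<noteq> {}" by auto
    have le: "p n \<le> 1 / 10 * ?N n powr (- 1 / 2)" using p ne by blast
    then have "(p n)\<^sup>2 \<le> (1 / 10 * ?N n powr (- 1 / 2))\<^sup>2"
      using p01 by (intro power_mono) auto
    also have "\<dots> = 1 / 100 * ?N n powr (- 1)"
      by (simp add: power_mult_distrib power2_eq_square flip: powr_add)
    also have "?N n powr (- 1) = 1 / ?N n"
      using elim by (simp add: powr_minus_divide)
    finally have "?N n * (p n)\<^sup>2 \<le> 1 / 100"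
      using elim by (simp add: field_simps)
    then have "measure_pmf.prob (random_subset (X n) (p n)) {Y. list_schur (G n) Y} \<le> 3 * p n"
      using G X p01 by (intro prob_list_schur_le) auto
    with le show ?case by simp
  qed
  then show "(\<lambda>n. measure_pmf.prob (random_subset (X n) (p n)) {Y. list_schur (G n) Y}) \<longlonglongrightarrow> 0"
    by (intro tendsto_sandwich[OF _ _ tendsto_const bound]) auto
qed

section \<open>Transfer to the natural numbers\<close>

text \<open>The generated subgroup is exhausted by countable stages, starting from the unit,
  \<open>X\<close> and the inverses and adding all products at each step. The stages increase, so
  any two elements share a stage and their product lies in the next.\<close>

lemma countable_generate:
  assumes "finite X"
  shows "countable (generate G X)"
proof -
  define step where "step S = S \<union> (\<lambda>(x, y). x \<otimes>\<^bsub>G\<^esub> y) ` (S \<times> S)" for S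
  define base where "base = insert \<one>\<^bsub>G\<^esub> (X \<union> m_inv G ` X)"
  have c: "countable ((step ^^ n) base)" for n
    using assms by (induction n) (auto simp: base_def step_def intro: countable_finite)
  have mono: "(step ^^ n) base \<subseteq> (step ^^ (n + k)) base" for n k
    by (induction k) (auto simp: step_def)
  have "x \<in> (\<Union>n. (step ^^ n) base)" if "x \<in> generate G X" for x
    using that
  proof (induction rule: generate.induct)
    case (eng x y)
    then obtain m n where "x \<in> (step ^^ m) base" "y \<in> (step ^^ n) base" by auto
    then have "x \<in> (step ^^ (m + n)) base" "y \<in> (step ^^ (m + n)) base"
      using mono[of m n] mono[of n m] by (auto simp: add.commute)
    then have "x \<otimes>\<^bsub>G\<^esub> y \<in> (step ^^ Suc (m + n)) base"
      by (auto simp: step_def)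
    then show ?case by blast
  qed (rule UN_I[of 0]; simp add: base_def)+
  then have "generate G X \<subseteq> (\<Union>n. (step ^^ n) base)" by (rule subsetI)
  moreover have "countable (\<Union>n. (step ^^ n) base)" using c by (rule countable_UN[OF countableI_type])
  ultimately show ?thesis by (rule countable_subset)
qed

lemma random_subset_insert:
  assumes "finite X" "x \<notin> X"
  shows "random_subset (insert x X) p =
    do {b \<leftarrow> bernoulli_pmf p; S \<leftarrow> random_subset X p; return_pmf (if b then insert x S else S)}"
proof -
  have "{y \<in> insert x X. (f(x := b)) y} = (if b then insert x {y \<in> X. f y} else {y \<in> X. f y})" for f b
    using assms(2) by auto
  then show ?thesis
    unfolding random_subset_def using assms
    by (simp add: Pi_pmf_insert' map_bind_pmf bind_map_pmf)
qed

text \<open>By induction: injectivity keeps \<open>f x\<close> new, so the independent decision on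
  \<open>x\<close> becomes the one on \<open>f x\<close>.\<close>

lemma random_subset_image:
  assumes "finite X" "inj_on f X"
  shows "random_subset (f ` X) p = map_pmf (image f) (random_subset X p)"
  using assms
proof (induction X rule: finite_induct)
  case empty
  then show ?case by (simp add: random_subset_def)
next
  case (insert x X)
  have "f x \<notin> f ` X" using insert by auto
  then show ?case
    using insert by (simp add: random_subset_insert map_bind_pmf bind_map_pmf if_distrib cong: if_cong)
qed

text \<open>The countable subgroup generated by \<open>X\<close> is transported along an
  enumeration. Only sums that stay in \<open>X\<close> matter for being list-Schur, so
  \<open>f\<close> is related to the operations on \<open>X\<close> alone.\<close>

lemma nat_copy:
  fixes G :: "'a monoid"
  assumes "comm_group G" "finite X" "X \<subseteq> carrier G"
  shows "\<exists>(H :: nat monoid) f. comm_group H \<and> inj_on f X \<and> f ` X \<subseteq> carrier H \<and>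
    (\<forall>a\<in>X. \<forall>b\<in>X. a \<otimes>\<^bsub>G\<^esub> b \<in> X \<longrightarrow> f a \<otimes>\<^bsub>H\<^esub> f b = f (a \<otimes>\<^bsub>G\<^esub> b))"
proof -
  interpret comm_group G by fact
  let ?S = "generate G X"
  define K where "K = G\<lparr>carrier := ?S\<rparr>"
  have sub: "subgroup ?S G" using generate_is_subgroup assms by blast
  interpret K: comm_group K
  proof (rule group.group_comm_groupI)
    show "group K" unfolding K_def using sub is_group by (rule subgroup.subgroup_is_group)
    show "x \<otimes>\<^bsub>K\<^esub> y = y \<otimes>\<^bsub>K\<^esub> x" if "x \<in> carrier K" "y \<in> carrier K" for x y
      using that subgroup.subset[OF sub] m_comm by (auto simp: K_def)
  qed
  define f where "f = to_nat_on ?S"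
  have inj: "inj_on f ?S" unfolding f_def using countable_generate[OF assms(2)] by (rule inj_on_to_nat_on)
  define H :: "nat monoid" where
    "H = \<lparr>carrier = UNIV, monoid.mult = (\<lambda>x y. f (inv_into ?S f x \<otimes>\<^bsub>G\<^esub> inv_into ?S f y)), one = 0\<rparr>"
  have hom: "f \<in> hom K H" using inj by (auto simp: hom_def K_def H_def)
  have "comm_group (H\<lparr>carrier := f ` carrier K, one := f \<one>\<^bsub>K\<^esub>\<rparr>)" (is "comm_group ?H")
    using K.hom_imp_img_comm_group[OF hom] .
  moreover have XS: "X \<subseteq> ?S" by (auto intro: generate.incl)
  have "inj_on f X" "f ` X \<subseteq> carrier ?H"
    "\<forall>a\<in>X. \<forall>b\<in>X. a \<otimes>\<^bsub>G\<^esub> b \<in> X \<longrightarrow> f a \<otimes>\<^bsub>?H\<^esub> f b = f (a \<otimes>\<^bsub>G\<^esub> b)"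
    using inj XS inj_on_subset[OF inj XS] by (auto simp: K_def H_def subset_iff)
  ultimately show ?thesis by blast
qed

text \<open>The lists are carried along \<open>f\<close>, and a colouring of the image is pulled
  back to \<open>Y\<close>, where it has a monochromatic sum that \<open>f\<close> maps to one in
  the image.\<close>

lemma list_schur_image:
  fixes f :: "'a \<Rightarrow> 'c"
  assumes inj: "inj_on f Y"
    and hom: "\<And>a b. a \<in> Y \<Longrightarrow> b \<in> Y \<Longrightarrow> a \<otimes>\<^bsub>G\<^esub> b \<in> Y \<Longrightarrow> f a \<otimes>\<^bsub>H\<^esub> f b = f (a \<otimes>\<^bsub>G\<^esub> b)"
    and schur: "list_schur G Y"
  shows "list_schur H (f ` Y)"
proof -
  obtain L :: "'a \<Rightarrow> nat set" where L: "\<forall>y\<in>Y. card (L y) = 2"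
    and mono: "\<And>col. \<forall>y\<in>Y. col y \<in> L y \<Longrightarrow> \<exists>a\<in>Y. \<exists>b\<in>Y. \<exists>c\<in>Y. a \<noteq> b \<and> a \<noteq> c \<and> b \<noteq> c \<and>
      col a = col b \<and> col b = col c \<and> a \<otimes>\<^bsub>G\<^esub> b = c"
    using schur unfolding list_schur_def by blast
  show ?thesis unfolding list_schur_def
  proof (intro exI[of _ "\<lambda>v. L (inv_into Y f v)"] conjI allI impI)
    show "\<forall>y\<in>f ` Y. card (L (inv_into Y f y)) = 2" using L inj by simp
  next
    fix col :: "'c \<Rightarrow> nat"
    assume "\<forall>y\<in>f ` Y. col y \<in> L (inv_into Y f y)"
    then have "\<forall>y\<in>Y. (col \<circ> f) y \<in> L y" using inj by auto
    from mono[OF this] obtain a b c where abc: "a \<in> Y" "b \<in> Y" "c \<in> Y" "a \<noteq> b" "a \<noteq> c" "b \<noteq> c"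
      "col (f a) = col (f b)" "col (f b) = col (f c)" "a \<otimes>\<^bsub>G\<^esub> b = c"
      by auto
    moreover from this have "f a \<noteq> f b" "f a \<noteq> f c" "f b \<noteq> f c" "f a \<otimes>\<^bsub>H\<^esub> f b = f c"
      using inj hom[of a b] by (auto dest: inj_onD)
    ultimately show "\<exists>a\<in>f ` Y. \<exists>b\<in>f ` Y. \<exists>c\<in>f ` Y. a \<noteq> b \<and> a \<noteq> c \<and> b \<noteq> c \<and>
        col a = col b \<and> col b = col c \<and> a \<otimes>\<^bsub>H\<^esub> b = c"
      by blast
  qed
qed

text \<open>The theorem asks for the transfer of every constant that works for \<open>nat\<close>,
  not only 1/10. For each \<open>n\<close> the set is copied to a group on \<open>nat\<close>; the
  probability of being list-Schur does not decrease, so the limit 0 for the copies forces the limit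
  0 for the given sets.\<close>

lemma not_list_schur_whp_transfer:
  assumes nat: "not_list_schur_whp TYPE(nat) c"
  shows "not_list_schur_whp TYPE('a) c"
  unfolding not_list_schur_whp_def
proof (intro allI impI)
  fix G :: "nat \<Rightarrow> 'a monoid" and X :: "nat \<Rightarrow> 'a set" and p :: "nat \<Rightarrow> real"
  assume G: "\<forall>n. comm_group (G n)" and X: "\<forall>n. finite (X n) \<and> X n \<subseteq> carrier (G n)"
    and lim: "filterlim (\<lambda>n. card (X n)) at_top sequentially"
    and p01: "\<forall>n. 0 \<le> p n \<and> p n \<le> 1"
    and p: "\<forall>n. X n \<noteq> {} \<longrightarrow> p n \<le> c * real (card (X n)) powr (- 1 / 2)"
  have "\<forall>n. \<exists>(H :: nat monoid) f. comm_group H \<and> inj_on f (X n) \<and> f ` X n \<subseteq> carrier H \<and>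
      (\<forall>a\<in>X n. \<forall>b\<in>X n. a \<otimes>\<^bsub>G n\<^esub> b \<in> X n \<longrightarrow> f a \<otimes>\<^bsub>H\<^esub> f b = f (a \<otimes>\<^bsub>G n\<^esub> b))"
    using G X by (intro allI nat_copy) auto
  then obtain H :: "nat \<Rightarrow> nat monoid" and f where H: "\<And>n. comm_group (H n)"
    and inj: "\<And>n. inj_on (f n) (X n)" and sub: "\<And>n. f n ` X n \<subseteq> carrier (H n)"
    and hom: "\<And>n a b. a \<in> X n \<Longrightarrow> b \<in> X n \<Longrightarrow> a \<otimes>\<^bsub>G n\<^esub> b \<in> X n \<Longrightarrow>
      f n a \<otimes>\<^bsub>H n\<^esub> f n b = f n (a \<otimes>\<^bsub>G n\<^esub> b)"
    by metis
  have card: "card (f n ` X n) = card (X n)" for n using inj by (rule card_image)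
  have nat_lim: "(\<lambda>n. measure_pmf.prob (random_subset (f n ` X n) (p n)) {Y. list_schur (H n) Y}) \<longlonglongrightarrow> 0"
    using nat[unfolded not_list_schur_whp_def, rule_format, of H "\<lambda>n. f n ` X n" p]
      H X sub lim p01 p by (simp add: card)
  have "measure_pmf.prob (random_subset (X n) (p n)) {Y. list_schur (G n) Y} \<le>
      measure_pmf.prob (random_subset (f n ` X n) (p n)) {Y. list_schur (H n) Y}" for n
  proof -
    have fin: "finite (X n)" using X by blast
    have "list_schur (H n) (f n ` Y)" if "Y \<subseteq> X n" "list_schur (G n) Y" for Y
      using inj_on_subset[OF inj that(1)] hom[of _ n] that by (intro list_schur_image) blast+
    then have "measure_pmf.prob (random_subset (X n) (p n)) {Y. list_schur (G n) Y} \<le>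
        measure_pmf.prob (random_subset (X n) (p n)) {Y. list_schur (H n) (f n ` Y)}"
      using set_random_subset[OF fin] by (intro measure_pmf.finite_measure_mono_AE) (auto simp: AE_measure_pmf_iff)
    then show ?thesis by (simp add: random_subset_image[OF fin inj])
  qed
  then show "(\<lambda>n. measure_pmf.prob (random_subset (X n) (p n)) {Y. list_schur (G n) Y}) \<longlonglongrightarrow> 0"
    by (intro tendsto_sandwich[OF _ _ tendsto_const nat_lim]) auto
qed

theorem theorem1p6:
  "(\<exists>c>0. not_list_schur_whp TYPE(nat) c) \<and>
   (\<forall>c>0. not_list_schur_whp TYPE(nat) c \<longrightarrow> not_list_schur_whp TYPE('a) c)"
proof (intro conjI exI[of _ "1 / 10"] allI impI)
  show "not_list_schur_whp TYPE(nat) (1 / 10)" by (rule not_list_schur_whp_one_tenth)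
qed (simp, rule not_list_schur_whp_transfer)

end
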